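(* For $n\ge 2$, the number of parking functions $\alpha=(\alpha_1,\dots,\alpha_n)$ of length $n$ having a tie in position $1$ (that is, $\alpha_1=\alpha_2$) is $(n+1)^{n-2}$.
   Context: Parking functions: $n$ cars enter a one-way street with spots $1,\dots,n$ in order; car $i$ has preferred spot $\alpha_i\in[n]$ and parks in spot $\alpha_i$ if free, otherwise in the next free spot after $\alpha_i$, if any. A list $\alpha\in[n]^n$ is a parking function of length $n$ if all cars park. *)

theory Defs
  imports Main
begin

definition free_spots :: "nat \<Rightarrow> nat set \<Rightarrow> nat \<Rightarrow> nat set" where
  "free_spots n occ a = {s. a \<le> s \<and> s \<le> n \<and> s \<notin> occ}"

definition parking_spot :: "nat \<Rightarrow> nat set \<Rightarrow> nat \<Rightarrow> nat option" where
  "parking_spot n occ a =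
     (if free_spots n occ a = {} then None else Some (Min (free_spots n occ a)))"

fun all_park :: "nat \<Rightarrow> nat set \<Rightarrow> nat list \<Rightarrow> bool" where
  "all_park n occ [] \<longleftrightarrow> True"
| "all_park n occ (a # as) \<longleftrightarrow>
     (case parking_spot n occ a of
        None \<Rightarrow> False
      | Some s \<Rightarrow> all_park n (insert s occ) as)"

definition parking_function :: "nat \<Rightarrow> nat list \<Rightarrow> bool" where
  "parking_function n \<alpha> \<longleftrightarrow> length \<alpha> = n \<and> set \<alpha> \<subseteq> {1..n} \<and> all_park n {} \<alpha>"

(* Positions are counted from 1, so the i-th entry of the list is \<alpha> ! (i - 1). *)
definition tie_at :: "nat list \<Rightarrow> nat \<Rightarrow> bool" where
  "tie_at \<alpha> i \<longleftrightarrow> 1 \<le> i \<and> i < length \<alpha> \<and> \<alpha> ! (i - 1) = \<alpha> ! i"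

end

theory Submission
  imports Defs
begin

text \<open>The proof is Pollak's circle argument. Add one spot to the street and close it up to a circle
  with $m = n + 1$ spots, the extra spot being $0$ (reached after spot $n$), and let the $n$ cars
  prefer any of the $m$ spots. On the circle every car finds a spot, so exactly one spot is
  empty at the end (\<open>circ_park_leaves_one_spot\<close>). As long as spot $0$ stays empty no car has wrapped
  around, so the cars have parked exactly as on the street; hence the parking functions are
  the preference lists that leave spot $0$ empty (\<open>parking_function_iff_circ_park\<close>).

  Rotating all preferences by $k$ rotates the empty spot by $k$ (\<open>circ_park_rotate\<close>). In a family
  of preference lists that is closed under rotation, each of the $m$ spots is therefore left empty
  by equally many lists, and one list in $m$ is a parking function
  (\<open>card_rotation_closed\<close>). A tie between the first two cars survives rotation, and $m^{n-1}$
  preference lists have it, so $m^{n-2}$ parking functions do.\<close>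

section \<open>Rotations of the circle\<close>

definition rotate_spot :: "nat \<Rightarrow> nat \<Rightarrow> nat \<Rightarrow> nat" where
  "rotate_spot m k x = (x + k) mod m"

lemma rotate_spot_less: "0 < m \<Longrightarrow> rotate_spot m k x < m"
  by (simp add: rotate_spot_def)

lemma rotate_spot_inverse:
  assumes "x < m" "k \<le> m"
  shows "rotate_spot m (m - k) (rotate_spot m k x) = x"
    and "rotate_spot m k (rotate_spot m (m - k) x) = x"
proof -
  have "((x + k) mod m + (m - k)) mod m = x"
    using assms by (simp only: mod_add_left_eq) simp
  moreover have "((x + (m - k)) mod m + k) mod m = x"
    using assms by (simp only: mod_add_left_eq) simp
  ultimately show "rotate_spot m (m - k) (rotate_spot m k x) = x"
    and "rotate_spot m k (rotate_spot m (m - k) x) = x"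
    by (simp_all only: rotate_spot_def)
qed

lemma inj_on_rotate_spot:
  assumes "k \<le> m"
  shows "inj_on (rotate_spot m k) {..<m}"
  using assms by (intro inj_on_inverseI[where g = "rotate_spot m (m - k)"])
    (simp add: rotate_spot_inverse)

section \<open>Parking on the circle\<close>

definition next_free :: "nat \<Rightarrow> nat set \<Rightarrow> nat \<Rightarrow> nat" where
  "next_free m occ a = (a + (LEAST d. (a + d) mod m \<notin> occ)) mod m"

fun circ_park :: "nat \<Rightarrow> nat set \<Rightarrow> nat list \<Rightarrow> nat set" where
  "circ_park m occ [] = occ"
| "circ_park m occ (a # as) = circ_park m (insert (next_free m occ a) occ) as"

lemma next_free_less: "0 < m \<Longrightarrow> next_free m occ a < m"
  by (simp add: next_free_def)

lemma next_free_notin: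
  assumes "s < m" "s \<notin> occ" "a < m"
  shows "next_free m occ a \<notin> occ"
proof -
  \<comment> \<open>The free spot \<open>s\<close> is met after at most one full turn.\<close>
  have "(a + (m - a + s)) mod m \<notin> occ"
    using assms by simp
  then show ?thesis
    unfolding next_free_def by (rule LeastI)
qed

lemma next_free_eqI:
  assumes "(a + d) mod m = s" "s \<notin> occ" "\<And>e. e < d \<Longrightarrow> (a + e) mod m \<in> occ"
  shows "next_free m occ a = s"
proof -
  have "(LEAST e. (a + e) mod m \<notin> occ) = d"
    using assms by (intro Least_equality) (auto simp: not_less[symmetric])
  with assms show ?thesis
    by (simp add: next_free_def)
qed

lemma circ_park_mono: "occ \<subseteq> circ_park m occ as"
  by (induction m occ as rule: circ_park.induct) auto

lemma circ_park_subset: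
  assumes "0 < m" "occ \<subseteq> {..<m}"
  shows "circ_park m occ as \<subseteq> {..<m}"
  using assms by (induction m occ as rule: circ_park.induct) (auto simp: next_free_less)

lemma card_circ_park:
  assumes "occ \<subseteq> {..<m}" "set as \<subseteq> {..<m}" "card occ + length as \<le> m"
  shows "card (circ_park m occ as) = card occ + length as"
  using assms
proof (induction m occ as rule: circ_park.induct)
  case (2 m occ a as)
  have fin: "finite occ"
    using "2.prems"(1) finite_subset by blast
  have "card occ < card {..<m}"
    using "2.prems"(3) by simp
  then obtain s where "s < m" "s \<notin> occ"
    using fin by (metis card_mono leD lessThan_iff subsetI)
  then have "next_free m occ a \<notin> occ"
    using "2.prems"(2) by (intro next_free_notin) auto
  then show ?case
    using 2 fin by (auto simp: next_free_less)
qed simp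

lemma circ_park_leaves_one_spot:
  assumes "length as = n" "set as \<subseteq> {..<Suc n}"
  shows "\<exists>!e. e < Suc n \<and> e \<notin> circ_park (Suc n) {} as"
proof -
  have sub: "circ_park (Suc n) {} as \<subseteq> {..<Suc n}"
    by (rule circ_park_subset) auto
  have "card (circ_park (Suc n) {} as) = n"
    using card_circ_park[of "{}" "Suc n" as] assms by simp
  then have "card ({..<Suc n} - circ_park (Suc n) {} as) = 1"
    unfolding card_Diff_subset[OF finite_subset[OF sub finite_lessThan] sub] by simp
  then obtain e where e: "{..<Suc n} - circ_park (Suc n) {} as = {e}"
    by (rule card_1_singletonE)
  have "x < Suc n \<and> x \<notin> circ_park (Suc n) {} as \<longleftrightarrow> x = e" for x
    using arg_cong[OF e, of "\<lambda>A. x \<in> A"] by (simp only: Diff_iff lessThan_iff singleton_iff)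
  then show ?thesis
    by simp
qed

section \<open>Rotating all preferences\<close>

lemma next_free_rotate:
  assumes "occ \<subseteq> {..<m}" "a < m" "k \<le> m"
  shows "next_free m (rotate_spot m k ` occ) (rotate_spot m k a)
         = rotate_spot m k (next_free m occ a)"
proof -
  have shift: "(rotate_spot m k a + d) mod m = rotate_spot m k ((a + d) mod m)" for d
    unfolding rotate_spot_def mod_add_left_eq by (simp only: ac_simps)
  \<comment> \<open>The rotated car drives exactly as far as the original one.\<close>
  have "(rotate_spot m k a + d) mod m \<notin> rotate_spot m k ` occ \<longleftrightarrow> (a + d) mod m \<notin> occ" for d
    unfolding shift
    using assms inj_on_image_mem_iff[OF inj_on_rotate_spot[OF assms(3)], of "(a + d) mod m" occ]
    by auto
  then show ?thesis
    unfolding next_free_def by (simp only: shift)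
qed

lemma circ_park_rotate:
  assumes "occ \<subseteq> {..<m}" "set as \<subseteq> {..<m}" "k \<le> m"
  shows "circ_park m (rotate_spot m k ` occ) (map (rotate_spot m k) as)
         = rotate_spot m k ` circ_park m occ as"
  using assms
proof (induction m occ as rule: circ_park.induct)
  case (2 m occ a as)
  then have "insert (next_free m occ a) occ \<subseteq> {..<m}"
    by (auto simp: next_free_less)
  with 2 show ?case
    by (simp add: next_free_rotate)
qed simp

section \<open>The street inside the circle\<close>

text \<open>The street is the circle cut open at spot $0$: a car that fails to park on the street, or
  that prefers spot $0$, is a car that takes spot $0$ on the circle if that is still
  empty.\<close>

lemma circ_park_avoids_0_iff:
  assumes "0 \<notin> occ" "set as \<subseteq> {..<Suc n}"
  shows "0 \<notin> circ_park (Suc n) occ as \<longleftrightarrow> set as \<subseteq> {1..n} \<and> all_park n occ as"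
  using assms
proof (induction as arbitrary: occ)
  case (Cons a as)
  let ?s = "next_free (Suc n) occ a"
  have a: "a \<le> n"
    using Cons.prems by auto
  have wrapped: "0 \<in> circ_park (Suc n) occ (a # as)" if "?s = 0"
    using that circ_park_mono[of "insert ?s occ" "Suc n" as] by auto
  show ?case
  proof (cases "a = 0")
    case True
    then have "?s = 0"
      using Cons.prems by (intro next_free_eqI[where d = 0]) auto
    with wrapped True show ?thesis
      by auto
  next
    case pos: False
    show ?thesis
    proof (cases "free_spots n occ a = {}")
      case True
      then have full: "s \<in> occ" if "a \<le> s" "s \<le> n" for s
        using that by (auto simp: free_spots_def)
      have "?s = 0"
        using a Cons.prems full by (intro next_free_eqI[where d = "Suc n - a"]) auto
      with wrapped True show ?thesis
        by (auto simp: parking_spot_def)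
    next
      case False
      define s where "s = Min (free_spots n occ a)"
      have fin: "finite (free_spots n occ a)"
        by (rule finite_subset[of _ "{..n}"]) (auto simp: free_spots_def)
      have s: "a \<le> s" "s \<le> n" "s \<notin> occ"
        using Min_in[OF fin False] by (auto simp: s_def free_spots_def)
      have before: "t \<in> occ" if "a \<le> t" "t < s" for t
      proof (rule ccontr)
        assume "t \<notin> occ"
        with that s have "t \<in> free_spots n occ a"
          by (simp add: free_spots_def)
        then have "s \<le> t"
          unfolding s_def using fin by (rule Min_le[rotated])
        with that show False
          by simp
      qed
      have "?s = s"
        using s before by (intro next_free_eqI[where d = "s - a"]) auto
      moreover have "parking_spot n occ a = Some s"
        using False by (simp add: parking_spot_def s_def)
      ultimately show ?thesis
        using Cons.IH[of "insert s occ"] Cons.prems pos s by auto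
    qed
  qed
qed simp

lemma parking_function_iff_circ_park:
  assumes "length as = n" "set as \<subseteq> {..<Suc n}"
  shows "parking_function n as \<longleftrightarrow> 0 \<notin> circ_park (Suc n) {} as"
  using assms circ_park_avoids_0_iff[of "{}" as n] by (simp add: parking_function_def)

section \<open>Counting by rotation classes\<close>

text \<open>The lists in \<open>T\<close> are sorted by the spot they leave empty. Rotation by $k$ is a bijection from
  the lists leaving spot $0$ empty, the parking functions, to those leaving spot $k$ empty,
  so all $n + 1$ classes have the same size.\<close>

lemma card_rotation_closed:
  assumes lists: "\<And>as. as \<in> T \<Longrightarrow> length as = n \<and> set as \<subseteq> {..<Suc n}"
    and closed: "\<And>as k. as \<in> T \<Longrightarrow> map (rotate_spot (Suc n) k) as \<in> T"
  shows "card T = Suc n * card {as \<in> T. parking_function n as}"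
proof -
  let ?m = "Suc n"
  define F where "F e = {as \<in> T. e \<notin> circ_park ?m {} as}" for e
  have "T \<subseteq> {as. set as \<subseteq> {..<?m} \<and> length as = n}"
    using lists by blast
  then have finT: "finite T"
    by (rule finite_subset) (rule finite_lists_length_eq[OF finite_lessThan])
  have rotated: "map (rotate_spot ?m k) as \<in> F (rotate_spot ?m k e)"
    if "as \<in> F e" "e < ?m" "k \<le> ?m" for as e k
  proof -
    have as: "as \<in> T" "e \<notin> circ_park ?m {} as"
      using that by (auto simp: F_def)
    have "rotate_spot ?m k e \<notin> rotate_spot ?m k ` circ_park ?m {} as"
      using inj_on_image_mem_iff[OF inj_on_rotate_spot[OF that(3)], of e "circ_park ?m {} as"]
        as that circ_park_subset[of ?m "{}" as] by auto
    then show ?thesis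
      using as closed lists[OF as(1)] circ_park_rotate[of "{}" ?m as k] that
      by (simp add: F_def)
  qed
  have inv: "map (rotate_spot ?m (?m - k)) (map (rotate_spot ?m k) as) = as"
      "map (rotate_spot ?m k) (map (rotate_spot ?m (?m - k)) as) = as"
    if "as \<in> T" "k \<le> ?m" for as k
    using lists[OF that(1)] that(2) by (auto simp: rotate_spot_inverse intro!: map_idI)
  have "bij_betw (map (rotate_spot ?m k)) (F 0) (F k)" if "k < ?m" for k
  proof (rule bij_betw_byWitness[where f' = "map (rotate_spot ?m (?m - k))"])
    have rot: "rotate_spot ?m k 0 = k" "rotate_spot ?m (?m - k) k = 0"
      using that by (simp_all add: rotate_spot_def)
    show "map (rotate_spot ?m k) ` F 0 \<subseteq> F k"
      using rotated[of _ 0 k] that rot(1) by auto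
    show "map (rotate_spot ?m (?m - k)) ` F k \<subseteq> F 0"
      using rotated[of _ k "?m - k"] that rot(2) by auto
  qed (use inv that in \<open>auto simp del: map_map simp: F_def\<close>)
  then have same: "card (F k) = card (F 0)" if "k < ?m" for k
    using that bij_betw_same_card by metis
  have "T = (\<Union>e\<in>{..<?m}. F e)"
    unfolding F_def using circ_park_leaves_one_spot[OF conjunct1 conjunct2, OF lists lists]
    by blast
  then have "card T = card (\<Union>e\<in>{..<?m}. F e)"
    by (rule arg_cong)
  also have "\<dots> = (\<Sum>e\<in>{..<?m}. card (F e))"
  proof (rule card_UN_disjoint)
    show "\<forall>i\<in>{..<?m}. \<forall>j\<in>{..<?m}. i \<noteq> j \<longrightarrow> F i \<inter> F j = {}"
      unfolding F_def using circ_park_leaves_one_spot[OF conjunct1 conjunct2, OF lists lists]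
      by blast
  qed (use finT in \<open>auto simp: F_def\<close>)
  also have "\<dots> = (\<Sum>e\<in>{..<?m}. card (F 0))"
    by (rule sum.cong) (use same in blast)+
  also have "\<dots> = ?m * card (F 0)"
    by simp
  also have "F 0 = {as \<in> T. parking_function n as}"
    unfolding F_def using parking_function_iff_circ_park[OF conjunct1 conjunct2, OF lists lists]
    by blast
  finally show ?thesis .
qed

lemma card_lists_first_two_equal:
  assumes "finite A"
  shows "card {as. length as = Suc (Suc r) \<and> set as \<subseteq> A \<and> as ! 0 = as ! 1} = card A ^ Suc r"
proof -
  have "bij_betw (\<lambda>bs. hd bs # bs) {bs. set bs \<subseteq> A \<and> length bs = Suc r}
      {as. length as = Suc (Suc r) \<and> set as \<subseteq> A \<and> as ! 0 = as ! 1}"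
  proof (rule bij_betw_byWitness[where f' = tl])
    show "\<forall>as\<in>{as. length as = Suc (Suc r) \<and> set as \<subseteq> A \<and> as ! 0 = as ! 1}. hd (tl as) # tl as = as"
    proof (clarify)
      fix as :: "'a list"
      assume "length as = Suc (Suc r)" "as ! 0 = as ! 1"
      then show "hd (tl as) # tl as = as"
        by (cases as; cases "tl as") auto
    qed
    show "(\<lambda>bs. hd bs # bs) ` {bs. set bs \<subseteq> A \<and> length bs = Suc r}
        \<subseteq> {as. length as = Suc (Suc r) \<and> set as \<subseteq> A \<and> as ! 0 = as ! 1}"
    proof (clarify)
      fix bs :: "'a list"
      assume "set bs \<subseteq> A" "length bs = Suc r"
      then show "length (hd bs # bs) = Suc (Suc r) \<and> set (hd bs # bs) \<subseteq> A
          \<and> (hd bs # bs) ! 0 = (hd bs # bs) ! 1"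
        by (cases bs) auto
    qed
    show "tl ` {as. length as = Suc (Suc r) \<and> set as \<subseteq> A \<and> as ! 0 = as ! 1}
        \<subseteq> {bs. set bs \<subseteq> A \<and> length bs = Suc r}"
      by (auto dest: list.set_sel(2)[rotated])
  qed simp
  then show ?thesis
    by (simp add: bij_betw_same_card[symmetric] card_lists_length_eq[OF assms] del: power_Suc)
qed

theorem lemma5p13:
  fixes n :: nat
  assumes "n \<ge> 2"
  shows "card {\<alpha>. parking_function n \<alpha> \<and> tie_at \<alpha> 1} = (n + 1) ^ (n - 2)"
proof -
  obtain r where n: "n = Suc (Suc r)"
    using assms by (metis add_2_eq_Suc le_Suc_ex)
  define T where "T = {as. length as = n \<and> set as \<subseteq> {..<Suc n} \<and> as ! 0 = as ! 1}"
  have "card T = Suc n ^ Suc r"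
    unfolding T_def n by (subst card_lists_first_two_equal) auto
  moreover have "card T = Suc n * card {as \<in> T. parking_function n as}"
    by (rule card_rotation_closed) (auto simp: T_def n rotate_spot_less)
  moreover have "{as \<in> T. parking_function n as} = {\<alpha>. parking_function n \<alpha> \<and> tie_at \<alpha> 1}"
    by (auto simp: T_def n parking_function_def tie_at_def)
  ultimately have "Suc n * card {\<alpha>. parking_function n \<alpha> \<and> tie_at \<alpha> 1} = Suc n * Suc n ^ r"
    by (simp only: power_Suc)
  then have "card {\<alpha>. parking_function n \<alpha> \<and> tie_at \<alpha> 1} = Suc n ^ r"
    by (simp only: mult_cancel1) simp
  then show ?thesis
    by (simp only: n) simp
qed

end
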